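(* Let $p\in4\mathbb{N}$ or $p\in4\mathbb{N}_0+1$. Then explicit Runge--Kutta schemes of order $p$ with $s=p$ stages (hence with stability function $R(z)=\sum_{j=0}^p z^j/j!$) are not strongly stable.
   Context: Runge--Kutta scheme: for the linear system $\frac{du}{dt}=\mathbf{L}u$, $u(0)=u^0\in\mathbb{C}^n$, $\mathbf{L}\in\mathbb{C}^{n\times n}$, and time step $\tau>0$, an explicit Runge--Kutta method with $s$ stages is $$u^k=u^{k-1}+\tau\sum_{i=1}^s b_iK_i^k,\qquad K_i^k=\mathbf{L}\Big(u^{k-1}+\tau\sum_{j=1}^{i-1}a_{ij}K_j^k\Big),\quad i=1,\dots,s.$$ It can be written as $u^k=R(\tau\mathbf{L})u^{k-1}$ with a polynomial $R$, the stability function. "Order $p$" refers to the order for linear systems; for $s=p$ the stability function is the truncated exponential $R(z)=\sum_{j=0}^p z^j/j!$. $\mathbf{L}\in\mathbb{C}^{n\times n}$ is Lyapunov stable if all its eigenvalues have nonpositive real part and those with zero real part are non-defective; equivalently, there is a positive definite Hermitian $\mathbf{P}$ with $\mathbf{L}^*\mathbf{P}+\mathbf{P}\mathbf{L}\le0$. For such $\mathbf{P}$, $\|u\|_{\mathbf{P}}=\sqrt{\langle u,\mathbf{P}u\rangle}$. Strong stability: the scheme is strongly stable if for all $n\in\mathbb{N}$, all Lyapunov stable $\mathbf{L}\in\mathbb{C}^{n\times n}$, and all positive definite Hermitian $\mathbf{P}\in\mathbb{C}^{n\times n}$ with $\mathbf{L}^*\mathbf{P}+\mathbf{P}\mathbf{L}\le0$,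 one has $\|u^1\|_{\mathbf{P}}\le\|u^0\|_{\mathbf{P}}$ for all $u^0\in\mathbb{C}^n$ and all sufficiently small time steps, i.e. there is $\tau_0>0$ (which may depend on $\mathbf{L}$ and $\mathbf{P}$) such that $\|R(\tau\mathbf{L})u^0\|_{\mathbf{P}}\le\|u^0\|_{\mathbf{P}}$ for all $0<\tau\le\tau_0$ and all $u^0\in\mathbb{C}^n$. $\mathbb{N}=\{1,2,\dots\}$, $\mathbb{N}_0=\mathbb{N}\cup\{0\}$. *)

theory Defs
  imports
    Complex_Main
    "HOL-Library.Landau_Symbols"
    "Jordan_Normal_Form.Matrix_Kernel"
    "Jordan_Normal_Form.Char_Poly"
    "Jordan_Normal_Form.Schur_Decomposition"
begin

hide_const (open) Coset.order

text \<open>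
  Since strong stability quantifies over the dimension, we use carrier-based matrices and vectors.
  An explicit Runge--Kutta scheme with \<open>s\<close> stages is given by real coefficients \<open>a i j\<close>
  (\<open>1 \<le> j < i \<le> s\<close>) and \<open>b i\<close> (\<open>1 \<le> i \<le> s\<close>); values at other indices are never used.
\<close>

function rk_stage ::
  "(nat \<Rightarrow> nat \<Rightarrow> real) \<Rightarrow> complex mat \<Rightarrow> real \<Rightarrow> complex vec \<Rightarrow> nat \<Rightarrow> complex vec" where
  "rk_stage a L \<tau> u i =
     L *\<^sub>v (u + complex_of_real \<tau> \<cdot>\<^sub>v
       vec (dim_vec u) (\<lambda>k. \<Sum>j\<in>{1..<i}. complex_of_real (a i j) * rk_stage a L \<tau> u j $ k))"
  by auto
termination
  by (relation "Wellfounded.measure (\<lambda>(a, L, \<tau>, u, i). i)") auto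

declare rk_stage.simps [simp del]

definition rk_step ::
  "(nat \<Rightarrow> nat \<Rightarrow> real) \<Rightarrow> (nat \<Rightarrow> real) \<Rightarrow> nat \<Rightarrow> complex mat \<Rightarrow> real \<Rightarrow> complex vec \<Rightarrow> complex vec" where
  "rk_step a b s L \<tau> u =
     u + complex_of_real \<tau> \<cdot>\<^sub>v
       vec (dim_vec u) (\<lambda>k. \<Sum>i\<in>{1..s}. complex_of_real (b i) * rk_stage a L \<tau> u i $ k)"

definition linear_ivp_solution ::
  "nat \<Rightarrow> complex mat \<Rightarrow> complex vec \<Rightarrow> (real \<Rightarrow> complex vec) \<Rightarrow> bool" where
  "linear_ivp_solution n L u0 u \<longleftrightarrow>
     u 0 = u0 \<and>
     (\<forall>t\<ge>0. u t \<in> carrier_vec n \<and>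
       (\<forall>i<n. ((\<lambda>t. u t $ i) has_vector_derivative (L *\<^sub>v u t) $ i) (at t within {0..})))"

text \<open>Order for linear systems: the local error is \<open>O(\<tau>\<^sup>p\<^sup>+\<^sup>1)\<close>, componentwise.\<close>

definition rk_linear_order ::
  "(nat \<Rightarrow> nat \<Rightarrow> real) \<Rightarrow> (nat \<Rightarrow> real) \<Rightarrow> nat \<Rightarrow> nat \<Rightarrow> bool" where
  "rk_linear_order a b s p \<longleftrightarrow>
     (\<forall>n\<ge>1. \<forall>L\<in>carrier_mat n n. \<forall>u0\<in>carrier_vec n. \<forall>u. linear_ivp_solution n L u0 u \<longrightarrow>
       (\<forall>i<n. (\<lambda>\<tau>. cmod (rk_step a b s L \<tau> u0 $ i - u \<tau> $ i)) \<in> O[at_right 0](\<lambda>\<tau>. \<tau> ^ (p + 1))))"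

text \<open>\<open>mat_poly_apply R A u\<close> is \<open>R(A) u\<close>.\<close>

definition mat_poly_apply :: "complex poly \<Rightarrow> complex mat \<Rightarrow> complex vec \<Rightarrow> complex vec" where
  "mat_poly_apply R A u =
     vec (dim_vec u) (\<lambda>k. \<Sum>j\<le>degree R. coeff R j * ((A ^\<^sub>m j) *\<^sub>v u) $ k)"

definition is_stability_function ::
  "(nat \<Rightarrow> nat \<Rightarrow> real) \<Rightarrow> (nat \<Rightarrow> real) \<Rightarrow> nat \<Rightarrow> complex poly \<Rightarrow> bool" where
  "is_stability_function a b s R \<longleftrightarrow>
     (\<forall>n\<ge>1. \<forall>L\<in>carrier_mat n n. \<forall>\<tau>>0. \<forall>u\<in>carrier_vec n.
       rk_step a b s L \<tau> u = mat_poly_apply R (complex_of_real \<tau> \<cdot>\<^sub>m L) u)"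

definition lyapunov_stable :: "complex mat \<Rightarrow> bool" where
  "lyapunov_stable L \<longleftrightarrow>
     (\<forall>ev. eigenvalue L ev \<longrightarrow> Re ev \<le> 0 \<and>
       (Re ev = 0 \<longrightarrow> kernel_dim (char_matrix L ev) = Polynomial.order ev (char_poly L)))"

definition hermitian_mat :: "complex mat \<Rightarrow> bool" where
  "hermitian_mat M \<longleftrightarrow> mat_adjoint M = M"

text \<open>For Hermitian \<open>M\<close> the form \<open>v \<bullet>c (M *\<^sub>v v)\<close> is real, so \<open>Re\<close> loses nothing.\<close>

definition pos_def_mat :: "nat \<Rightarrow> complex mat \<Rightarrow> bool" where
  "pos_def_mat n M \<longleftrightarrow>
     hermitian_mat M \<and> (\<forall>v\<in>carrier_vec n. v \<noteq> 0\<^sub>v n \<longrightarrow> Re (v \<bullet>c (M *\<^sub>v v)) > 0)"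

definition neg_semidef_mat :: "nat \<Rightarrow> complex mat \<Rightarrow> bool" where
  "neg_semidef_mat n M \<longleftrightarrow>
     hermitian_mat M \<and> (\<forall>v\<in>carrier_vec n. Re (v \<bullet>c (M *\<^sub>v v)) \<le> 0)"

definition P_norm :: "complex mat \<Rightarrow> complex vec \<Rightarrow> real" where
  "P_norm P u = sqrt (Re (u \<bullet>c (P *\<^sub>v u)))"

definition strongly_stable :: "(nat \<Rightarrow> nat \<Rightarrow> real) \<Rightarrow> (nat \<Rightarrow> real) \<Rightarrow> nat \<Rightarrow> bool" where
  "strongly_stable a b s \<longleftrightarrow>
     (\<forall>n\<ge>1. \<forall>L\<in>carrier_mat n n. \<forall>P\<in>carrier_mat n n.
       lyapunov_stable L \<and> pos_def_mat n P \<and> neg_semidef_mat n (mat_adjoint L * P + P * L) \<longrightarrow>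
       (\<exists>\<tau>0>0. \<forall>\<tau>. 0 < \<tau> \<and> \<tau> \<le> \<tau>0 \<longrightarrow>
         (\<forall>u0\<in>carrier_vec n. P_norm P (rk_step a b s L \<tau> u0) \<le> P_norm P u0)))"

definition truncated_exp :: "nat \<Rightarrow> complex poly" where
  "truncated_exp p = (\<Sum>j\<le>p. monom (1 / fact j) j)"

end

(*
Take L = the Jordan block of size k + 1 with eigenvalue -1 and P_ij = binom(i+j, i) / 2^(i+j), which
is up to a factor 2 the Gram matrix of t^i/i! exp(-t) in L^2(0, oo). Then L^* P + P L = -2 e_0 e_0^*,
L acts on coefficient sequences as the forward difference, and y_j = (L^j u)_0 can be prescribed for
j <= k. With R_t = R(t L) one has
  d/dt |R_t u|^2 = -2 (sum_{j<=p} y_j t^j/j!)^2 - 2 t^p/p! <R_t u, L^(p+1) u>.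
Let k = ceil(p/2) and y_j = q_j tau^(k-j); rescaling t = tau s turns |R_tau u|^2 - |u|^2 into tau^(p+1)
times a continuous function of tau whose value at 0 only has to be positive.
For p = 4m + 1 take q_j = delta_jk: the dissipation is of higher order, and moving half of the powers
of L across gives <u, L^(p+1) u> = (-1)^k |L^k u|^2 < 0 since k is odd.
For p = 4m one gets <u, L^(p+1) u> = -q_k^2 at tau = 0, and the gain q_k^2/(p+1)! must beat the integral
over [0, 1] of the square of the polynomial sum_j q_j s^j/j!.
*)
theory Submission
  imports
    "HOL-Analysis.Gamma_Function"
    "Jordan_Normal_Form.Jordan_Normal_Form"
    Defs
begin

unbundle no vec_syntax

section \<open>Energy growth of truncated exponentials\<close>

text \<open>Differentiating \<open>t ^ j / fact j\<close> lowers the index by one, which amounts to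
  raising the index of \<open>H\<close>. The top term has no partner and becomes the truncation
  defect.\<close>

lemma sum_mult_deriv_power_div_fact:
  fixes t :: real and H :: "nat \<Rightarrow> real"
  shows "(\<Sum>j\<le>p. (real j * t ^ (j - 1) / fact j) * H j)
    = (\<Sum>j\<le>p. t ^ j / fact j * H (Suc j)) - t ^ p / fact p * H (Suc p)"
proof -
  have "(\<Sum>j\<le>p. (real j * t ^ (j - 1) / fact j) * H j)
      = (\<Sum>j<p. (real (Suc j) * t ^ j / fact (Suc j)) * H (Suc j))"
    by (simp add: sum.atMost_shift)
  also have "\<dots> = (\<Sum>j<p. t ^ j / fact j * H (Suc j))"
    by (intro sum.cong refl) (simp del: of_nat_Suc)
  also have "\<dots> = (\<Sum>j\<le>p. t ^ j / fact j * H (Suc j)) - t ^ p / fact p * H (Suc p)"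
    by (simp add: lessThan_Suc_atMost [symmetric])
  finally show ?thesis .
qed

text \<open>\<open>G i j\<close> stands for the inner product of L^i u and L^j u, \<open>y i\<close>
  for (L^i u)_0, and \<open>rel\<close> for the Lyapunov equation with right-hand side -2 e_0 e_0^*.
  A truncated exponential solves R' = L R - (t^p/p!) L^(p+1); the first term yields the dissipation,
  the second the remaining sum.\<close>

lemma has_real_derivative_energy:
  fixes G :: "nat \<Rightarrow> nat \<Rightarrow> real" and y :: "nat \<Rightarrow> real"
  assumes sym: "\<And>i j. G i j = G j i"
    and rel: "\<And>i j. G (Suc i) j + G i (Suc j) = - 2 * y i * y j"
  shows "((\<lambda>t. \<Sum>i\<le>p. \<Sum>j\<le>p. t ^ i / fact i * (t ^ j / fact j) * G i j) has_real_derivative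
    - 2 * (\<Sum>i\<le>p. t ^ i / fact i * y i)\<^sup>2
    - 2 * (t ^ p / fact p) * (\<Sum>i\<le>p. t ^ i / fact i * G i (Suc p))) (at t)"
proof -
  define e where "e i = t ^ i / fact i" for i
  define e' where "e' i = real i * t ^ (i - 1) / fact i" for i
  have "((\<lambda>t. \<Sum>i\<le>p. \<Sum>j\<le>p. t ^ i / fact i * (t ^ j / fact j) * G i j) has_real_derivative
     (\<Sum>i\<le>p. \<Sum>j\<le>p. (e i * e' j + e' i * e j) * G i j)) (at t)"
  proof -
    have D: "((\<lambda>t. t ^ i / fact i) has_real_derivative e' i) (at t)" for i
      unfolding e'_def by (auto intro!: derivative_eq_intros)
    show ?thesis
      by (intro DERIV_sum DERIV_cmult_right DERIV_cong [OF DERIV_mult [OF D D]])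
        (simp add: e_def mult.commute)
  qed
  also have "(\<Sum>i\<le>p. \<Sum>j\<le>p. (e i * e' j + e' i * e j) * G i j)
     = (\<Sum>i\<le>p. e i * (\<Sum>j\<le>p. e' j * G i j)) + (\<Sum>j\<le>p. e j * (\<Sum>i\<le>p. e' i * G i j))"
    by (subst (2) sum_distrib_left, subst (2) sum.swap)
      (simp add: sum_distrib_left sum.distrib algebra_simps)
  also have "\<dots> = (\<Sum>i\<le>p. e i * (\<Sum>j\<le>p. e j * G i (Suc j)) - e p * (e i * G i (Suc p)))
     + (\<Sum>j\<le>p. e j * (\<Sum>i\<le>p. e i * G (Suc i) j) - e p * (e j * G (Suc p) j))"
    unfolding e_def e'_def
    by (subst (1 2) sum_mult_deriv_power_div_fact) (simp add: algebra_simps)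
  \<comment> \<open>The two defect terms coincide by symmetry of \<open>G\<close>, hence the factor
    2.\<close>
  also have "\<dots> = (\<Sum>i\<le>p. e i * (\<Sum>j\<le>p. e j * G i (Suc j))) + (\<Sum>j\<le>p. e j * (\<Sum>i\<le>p. e i * G (Suc i) j))
      - 2 * e p * (\<Sum>i\<le>p. e i * G i (Suc p))"
    by (simp add: sum_subtractf sum_distrib_left [symmetric] sym [of "Suc p"])
  also have "(\<Sum>j\<le>p. e j * (\<Sum>i\<le>p. e i * G (Suc i) j)) = (\<Sum>i\<le>p. e i * (\<Sum>j\<le>p. e j * G (Suc i) j))"
    by (simp add: sum_distrib_left, subst sum.swap) (simp add: mult.left_commute)
  also have "(\<Sum>i\<le>p. e i * (\<Sum>j\<le>p. e j * G i (Suc j))) + \<dots>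
      = (\<Sum>i\<le>p. e i * (\<Sum>j\<le>p. e j * (G (Suc i) j + G i (Suc j))))"
    by (simp add: sum.distrib algebra_simps)
  also have "\<dots> = - 2 * (\<Sum>i\<le>p. e i * y i)\<^sup>2"
    unfolding rel by (simp add: power2_eq_square sum_product sum_distrib_left sum_negf algebra_simps)
  finally show ?thesis by (simp add: e_def)
qed

text \<open>The vector u, hence \<open>G\<close> and \<open>y\<close>, may vary with \<tau>. Running
  time \<open>\<tau> * s\<close> gives the defect a factor \<open>\<tau> ^ p\<close>; hypothesis
  \<open>Z\<close> asks the same of the dissipation, and the chain rule supplies one more \<tau>.
  The remaining factor is continuous in \<tau>, so its sign at 0 decides.\<close>

lemma energy_increase:
  fixes G :: "real \<Rightarrow> nat \<Rightarrow> nat \<Rightarrow> real" and y :: "real \<Rightarrow> nat \<Rightarrow> real"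
    and Z :: "real \<Rightarrow> real \<Rightarrow> real"
  assumes sym: "\<And>\<tau> i j. G \<tau> i j = G \<tau> j i"
    and rel: "\<And>\<tau> i j. G \<tau> (Suc i) j + G \<tau> i (Suc j) = - 2 * y \<tau> i * y \<tau> j"
    and contG: "\<And>i. continuous_on UNIV (\<lambda>\<tau>. G \<tau> i (Suc p))"
    and contZ: "continuous_on UNIV (\<lambda>(\<tau>, s). Z \<tau> s)"
    and Z: "\<And>\<tau> s. (\<Sum>i\<le>p. (\<tau> * s) ^ i / fact i * y \<tau> i)\<^sup>2 = \<tau> ^ p * Z \<tau> s"
    and neg: "integral {0..1} (Z 0) + G 0 0 (Suc p) / fact (Suc p) < 0"
  shows "\<forall>\<^sub>F \<tau> in at_right 0.
    G \<tau> 0 0 < (\<Sum>i\<le>p. \<Sum>j\<le>p. \<tau> ^ i / fact i * (\<tau> ^ j / fact j) * G \<tau> i j)"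
proof -
  \<comment> \<open>Two arguments keep the \<tau> that selects u apart from the running time
    \<open>t\<close>; only \<open>t\<close> is differentiated, and \<open>t = \<tau>\<close> is the
    Runge--Kutta step.\<close>
  define g where "g \<tau> t = (\<Sum>i\<le>p. \<Sum>j\<le>p. t ^ i / fact i * (t ^ j / fact j) * G \<tau> i j)" for \<tau> t
  define \<Phi> where "\<Phi> \<tau> s = - 2 * Z \<tau> s
      - 2 * (s ^ p / fact p) * (\<Sum>i\<le>p. (\<tau> * s) ^ i / fact i * G \<tau> i (Suc p))" for \<tau> s
  define F where "F \<tau> = integral {0..1} (\<Phi> \<tau>)" for \<tau>
  have contG': "continuous_on UNIV (\<lambda>x. G (fst x) i (Suc p))" for i
    by (rule continuous_on_compose2 [OF contG]) (auto intro!: continuous_intros)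
  have cont\<Phi>: "continuous_on UNIV (\<lambda>(\<tau>, s). \<Phi> \<tau> s)"
    using contZ unfolding \<Phi>_def case_prod_beta by (intro continuous_intros contG') auto
  have "Z 0 integrable_on {0..1}"
  proof (rule integrable_continuous_interval)
    have "continuous_on {0..1} (\<lambda>s. (0 :: real, s :: real))"
      by (intro continuous_intros)
    from continuous_on_compose2 [OF contZ this] show "continuous_on {0..1} (Z 0)"
      by simp
  qed
  have contF: "continuous_on UNIV F"
    unfolding F_def cbox_interval [symmetric]
    by (rule integral_continuous_on_param) (rule continuous_on_subset [OF cont\<Phi>], simp)
  have diff: "g \<tau> \<tau> - g \<tau> 0 = \<tau> ^ Suc p * F \<tau>" for \<tau>
  proof -
    have "((\<lambda>s. g \<tau> (\<tau> * s)) has_real_derivative \<tau> ^ Suc p * \<Phi> \<tau> s) (at s)" for s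
    proof -
      have "((\<lambda>s. g \<tau> (\<tau> * s)) has_real_derivative
        (- 2 * (\<Sum>i\<le>p. (\<tau> * s) ^ i / fact i * y \<tau> i)\<^sup>2
         - 2 * ((\<tau> * s) ^ p / fact p) * (\<Sum>i\<le>p. (\<tau> * s) ^ i / fact i * G \<tau> i (Suc p))) * \<tau>) (at s)"
        unfolding g_def
        by (rule DERIV_chain' [OF _ has_real_derivative_energy [where G = "G \<tau>" and y = "y \<tau>", OF sym rel]])
          (auto intro!: derivative_eq_intros)
      moreover have "(- 2 * (\<tau> ^ p * Z \<tau> s)
         - 2 * ((\<tau> * s) ^ p / fact p) * (\<Sum>i\<le>p. (\<tau> * s) ^ i / fact i * G \<tau> i (Suc p))) * \<tau>
         = \<tau> ^ Suc p * \<Phi> \<tau> s"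
        unfolding \<Phi>_def power_mult_distrib [of \<tau> s p] by (simp add: algebra_simps)
      ultimately show ?thesis unfolding Z by (simp only:)
    qed
    then have "((\<lambda>s. \<tau> ^ Suc p * \<Phi> \<tau> s) has_integral g \<tau> (\<tau> * 1) - g \<tau> (\<tau> * 0)) {0..1}"
      by (intro fundamental_theorem_of_calculus)
        (auto simp: has_real_derivative_iff_has_vector_derivative [symmetric] intro: has_field_derivative_at_within)
    then show ?thesis unfolding F_def
      by (metis integral_mult_right integral_unique mult.right_neutral mult_zero_right)
  qed
  \<comment> \<open>At \<open>\<tau> = 0\<close> only the summand \<open>i = 0\<close> survives, and
    integrating \<open>s ^ p / fact p\<close> gives \<open>1 / fact (Suc p)\<close>.\<close>
  have "F 0 = - 2 * (integral {0..1} (Z 0) + G 0 0 (Suc p) / fact (Suc p))"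
  proof -
    have sum0: "(\<Sum>i\<le>p. 0 ^ i / fact i * G 0 i (Suc p)) = G 0 0 (Suc p)"
      by (simp add: sum.atMost_shift)
    have "((\<lambda>s. s ^ Suc p / fact (Suc p)) has_real_derivative s ^ p / fact p) (at s)" for s :: real
      by (rule DERIV_cong [OF DERIV_cdivide [OF DERIV_pow]]) (simp del: of_nat_Suc)
    then have "((\<lambda>s. s ^ p / fact p) has_integral
        1 ^ Suc p / fact (Suc p) - 0 ^ Suc p / fact (Suc p)) {0..1::real}"
      by (intro fundamental_theorem_of_calculus)
        (auto simp flip: has_real_derivative_iff_has_vector_derivative intro: has_field_derivative_at_within)
    then have "((\<lambda>s. s ^ p / fact p) has_integral 1 / fact (Suc p)) {0..1::real}"
      by (simp del: fact_Suc)
    then have "((\<lambda>s. - 2 * (Z 0 s + G 0 0 (Suc p) * (s ^ p / fact p))) has_integral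
       - 2 * (integral {0..1} (Z 0) + G 0 0 (Suc p) * (1 / fact (Suc p)))) {0..1}"
      by (intro has_integral_mult_right has_integral_add integrable_integral \<open>Z 0 integrable_on {0..1}\<close>)
    moreover have "\<Phi> 0 = (\<lambda>s. - 2 * (Z 0 s + G 0 0 (Suc p) * (s ^ p / fact p)))"
      unfolding \<Phi>_def mult_zero_left sum0 by (auto simp: algebra_simps)
    ultimately show ?thesis unfolding F_def
      by (simp add: integral_unique del: fact_Suc)
  qed
  with neg have "F 0 > 0" by simp
  moreover have "(F \<longlongrightarrow> F 0) (at_right 0)"
    using contF by (auto simp: continuous_on_eq_continuous_at isCont_def intro: filterlim_at_split [THEN iffD1, THEN conjunct2])
  ultimately have "\<forall>\<^sub>F \<tau> in at_right 0. F \<tau> > 0"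
    by (rule order_tendstoD(1) [rotated])
  moreover have "\<forall>\<^sub>F \<tau> in at_right (0::real). \<tau> > 0"
    by (simp add: eventually_at_right_less)
  ultimately show ?thesis
  proof eventually_elim
    case (elim \<tau>)
    have "g \<tau> 0 = G \<tau> 0 0"
      by (simp add: g_def sum.atMost_shift)
    moreover have "\<tau> ^ Suc p * F \<tau> > 0"
      using elim by (intro mult_pos_pos zero_less_power)
    ultimately show ?case
      using diff [of \<tau>] by (simp add: g_def)
  qed
qed

text \<open>While \<open>y\<close> vanishes, \<open>rel\<close> makes the shift skew-symmetric: each
  power of L moved from one argument of the form to the other costs a sign.\<close>

lemma gram_alternating:
  fixes G :: "nat \<Rightarrow> nat \<Rightarrow> real" and y :: "nat \<Rightarrow> real"
  assumes rel: "\<And>i j. G (Suc i) j + G i (Suc j) = - 2 * y i * y j"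
    and y: "\<And>i. i < k \<Longrightarrow> y i = 0" and "j \<le> k"
  shows "G 0 (j + r) = (-1) ^ j * G j r"
  using \<open>j \<le> k\<close>
proof (induction j arbitrary: r)
  case (Suc j)
  have "G 0 (Suc j + r) = (-1) ^ j * G j (Suc r)"
    using Suc.IH [of "Suc r"] Suc.prems by simp
  also have "G j (Suc r) = - G (Suc j) r"
    using rel [of j r] y [of j] Suc.prems by simp
  finally show ?case by simp
qed simp

section \<open>The Beta integral and a polynomial of small mean square\<close>

lemma has_integral_power_mult_power_one_minus:
  assumes "k \<ge> 1"
  shows "((\<lambda>s::real. s ^ k * (1 - s) ^ k) has_integral (fact k)\<^sup>2 / fact (2 * k + 1)) {0..1}"
proof -
  have "((\<lambda>t. t powr (real (k + 1) - 1) * (1 - t) powr (real (k + 1) - 1)) has_integral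
      Beta (real (k + 1)) (real (k + 1))) {0..1}"
    by (rule has_integral_Beta_real) auto
  moreover have "Beta (real (k + 1)) (real (k + 1)) = (fact k)\<^sup>2 / fact (2 * k + 1)"
    using Gamma_fact [of k, where 'a = real] Gamma_fact [of "2 * k + 1", where 'a = real]
    by (simp add: Beta_def power2_eq_square add_ac)
  ultimately have "((\<lambda>t. t powr real k * (1 - t) powr real k) has_integral (fact k)\<^sup>2 / fact (2 * k + 1)) {0..1}"
    by simp
  \<comment> \<open>At the endpoints \<open>0 powr 0 = 0\<close> while \<open>0 ^ 0 = 1\<close>, so
    the two integrands agree everywhere because \<open>k \<ge> 1\<close>.\<close>
  then show ?thesis
    by (rule has_integral_eq [rotated]) (use assms in \<open>simp add: powr_realpow'\<close>)
qed

text \<open>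
  By the Beta integral, \<open>s\<^sup>m (1 - s)\<^sup>m\<close> attains equality in the bound below; subtracting its
  mean makes the inequality strict without changing the leading coefficient.
\<close>

lemma exists_small_polynomial:
  assumes "m \<ge> 1"
  shows "\<exists>q :: nat \<Rightarrow> real. (q (2 * m))\<^sup>2 = (fact (2 * m))\<^sup>2 \<and>
    integral {0..1} (\<lambda>s. (\<Sum>j\<le>2 * m. s ^ j / fact j * q j)\<^sup>2) < (fact (2 * m))\<^sup>2 / fact (4 * m + 1)"
proof -
  define I :: real where "I = (fact m)\<^sup>2 / fact (2 * m + 1)"
  \<comment> \<open>\<open>[:0, 1, -1:]\<close> is s (1 - s), and \<open>I\<close> is the mean over
    [0, 1] of its power \<open>m\<close>.\<close>
  define Q where "Q = [:0, 1, -1:] ^ m - [:I:]"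
  have Q: "poly Q s = s ^ m * (1 - s) ^ m - I" for s
    by (simp add: Q_def poly_power algebra_simps flip: power_mult_distrib)
  have deg: "degree ([:0, 1, -1 :: real:] ^ m) = 2 * m"
    by (simp add: degree_power_eq)
  have lc: "coeff ([:0, 1, -1 :: real:] ^ m) (2 * m) = (-1) ^ m"
    using lead_coeff_power [of "[:0, 1, -1 :: real:]" m] deg by simp
  have "degree Q \<le> 2 * m"
    unfolding Q_def by (rule degree_diff_le) (auto simp: deg)
  \<comment> \<open>The factorials turn ordinary coefficients into the Taylor data
    \<open>q j\<close>.\<close>
  then have poly_Q: "poly Q s = (\<Sum>j\<le>2 * m. s ^ j / fact j * (fact j * coeff Q j))" for s
    by (simp add: poly_altdef mult.commute sum.mono_neutral_left [of "{..2 * m}" "{..degree Q}"] coeff_eq_0)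
  have "coeff Q (2 * m) = (-1) ^ m"
    using assms lc by (cases m) (auto simp: Q_def)
  then have 1: "(fact (2 * m) * coeff Q (2 * m))\<^sup>2 = (fact (2 * m))\<^sup>2"
    by (simp add: power_mult_distrib flip: power_mult)
  \<comment> \<open>Expanding the square leaves Beta integrals with exponents \<open>2 * m\<close>
    and \<open>m\<close>. The terms in \<open>I\<close> add up to \<open>- I\<^sup>2\<close>, which
    makes the bound strict.\<close>
  have "((\<lambda>s. s ^ (2 * m) * (1 - s) ^ (2 * m) - 2 * I * (s ^ m * (1 - s) ^ m) + I\<^sup>2) has_integral
     (fact (2 * m))\<^sup>2 / fact (2 * (2 * m) + 1) - 2 * I * I + I\<^sup>2) {0..1::real}"
    unfolding I_def
    using assms has_integral_const_real [of "((fact m)\<^sup>2 / fact (2 * m + 1))\<^sup>2 :: real" 0 1]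
    by (intro has_integral_add has_integral_diff has_integral_mult_right
         has_integral_power_mult_power_one_minus) simp_all
  moreover have "s ^ (2 * m) * (1 - s) ^ (2 * m) - 2 * I * (s ^ m * (1 - s) ^ m) + I\<^sup>2 = (poly Q s)\<^sup>2" for s
  proof -
    have "s ^ (2 * m) * (1 - s) ^ (2 * m) = (s ^ m * (1 - s) ^ m)\<^sup>2"
      by (simp add: power_mult_distrib mult.commute flip: power_mult)
    then show ?thesis by (simp only: Q power2_diff) (simp only: ac_simps)
  qed
  ultimately have "integral {0..1} (\<lambda>s. (poly Q s)\<^sup>2) = (fact (2 * m))\<^sup>2 / fact (2 * (2 * m) + 1) - 2 * I * I + I\<^sup>2"
    by (metis (no_types, lifting) ext integral_unique)
  then have "integral {0..1} (\<lambda>s. (poly Q s)\<^sup>2) = (fact (2 * m))\<^sup>2 / fact (4 * m + 1) - I\<^sup>2"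
    by (simp only: power2_eq_square) simp
  moreover have "I > 0" by (simp add: I_def)
  ultimately have "integral {0..1} (\<lambda>s. (poly Q s)\<^sup>2) < (fact (2 * m))\<^sup>2 / fact (4 * m + 1)"
    by simp
  with 1 show ?thesis
    unfolding poly_Q by (intro exI [of _ "\<lambda>j. fact j * coeff Q j"] conjI)
qed

section \<open>The Pascal form and forward differences\<close>

abbreviation fdiff :: "(nat \<Rightarrow> 'a::ab_group_add) \<Rightarrow> nat \<Rightarrow> 'a" where
  "fdiff x \<equiv> \<lambda>i. x (Suc i) - x i"

definition pascal_weight :: "nat \<Rightarrow> nat \<Rightarrow> real" where
  "pascal_weight i j = real ((i + j) choose i) / 2 ^ (i + j)"

lemma pascal_weight_sym: "pascal_weight i j = pascal_weight j i"
  using binomial_symmetric [of i "i + j"] by (simp add: pascal_weight_def add.commute)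

text \<open>Pascal's rule divided by a power of 2. The left-hand side is the entry of L^* P + P L,
  with 0 for weights outside the matrix.\<close>

lemma pascal_weight_lyapunov:
  "(if i = 0 then 0 else pascal_weight (i - 1) j) + (if j = 0 then 0 else pascal_weight i (j - 1))
    - 2 * pascal_weight i j = (if i = 0 \<and> j = 0 then -2 else 0)"
  by (cases i; cases j) (simp_all add: pascal_weight_def field_simps)

text \<open>Vandermonde's identity gives P = B B^T with the triangular matrix B_il = binom(i, l) /
  2^i, from which positive definiteness follows. Summing up to \<open>k\<close> adds only vanishing
  binomials.\<close>

lemma pascal_weight_factor:
  assumes "i \<le> k" "j \<le> k"
  shows "pascal_weight i j = (\<Sum>l\<le>k. real (i choose l) / 2 ^ i * (real (j choose l) / 2 ^ j))"
proof -
  have "(i + j) choose i = (\<Sum>l\<le>i. (i choose l) * (j choose (i - l)))"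
    by (rule vandermonde [symmetric])
  also have "\<dots> = (\<Sum>l\<le>i. (i choose (i - l)) * (j choose (i - l)))"
    by (intro sum.cong refl) (simp add: binomial_symmetric [symmetric])
  also have "\<dots> = (\<Sum>l\<le>i. (i choose l) * (j choose l))"
    by (rule sum.reindex_bij_witness [of _ "\<lambda>l. i - l" "\<lambda>l. i - l"]) auto
  also have "\<dots> = (\<Sum>l\<le>k. (i choose l) * (j choose l))"
    using assms by (intro sum.mono_neutral_left) (auto simp: binomial_eq_0)
  finally show ?thesis
    by (simp add: pascal_weight_def power_add sum_divide_distrib)
qed

definition pascal_form :: "nat \<Rightarrow> (nat \<Rightarrow> real) \<Rightarrow> (nat \<Rightarrow> real) \<Rightarrow> real" where
  "pascal_form k x y = (\<Sum>i\<le>k. \<Sum>j\<le>k. pascal_weight i j * x i * y j)"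

lemma pascal_form_sym: "pascal_form k x y = pascal_form k y x"
  unfolding pascal_form_def
  by (subst sum.swap) (simp add: pascal_weight_sym mult.assoc mult.commute mult.left_commute)

lemma sum_weight_shift_index:
  fixes x w :: "nat \<Rightarrow> real"
  assumes "x (Suc k) = 0"
  shows "(\<Sum>i\<le>k. w i * x (Suc i)) = (\<Sum>i\<le>k. (if i = 0 then 0 else w (i - 1)) * x i)"
proof -
  have "(\<Sum>i\<le>k. w i * x (Suc i)) = (\<Sum>i<k. w i * x (Suc i))"
    using assms by (simp add: lessThan_Suc_atMost [symmetric])
  then show ?thesis by (simp add: sum.atMost_shift)
qed

text \<open>The Lyapunov equation as a bilinear identity. Shifts of the arguments are moved onto the
  weights; the zero at \<open>Suc k\<close> removes the upper boundary term and matches the last row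
  of the Jordan block.\<close>

lemma pascal_form_fdiff:
  assumes "x (Suc k) = 0" "y (Suc k) = 0"
  shows "pascal_form k (fdiff x) y + pascal_form k x (fdiff y) = - 2 * x 0 * y 0"
proof -
  have 1: "(\<Sum>i\<le>k. \<Sum>j\<le>k. pascal_weight i j * x (Suc i) * y j) =
     (\<Sum>i\<le>k. \<Sum>j\<le>k. (if i = 0 then 0 else pascal_weight (i - 1) j) * x i * y j)"
    by (subst (1 2) sum.swap, rule sum.cong [OF refl])
      (use sum_weight_shift_index [of x k "\<lambda>i. pascal_weight i j" for j] assms
        in \<open>simp flip: sum_distrib_right\<close>)
  have 2: "(\<Sum>i\<le>k. \<Sum>j\<le>k. pascal_weight i j * x i * y (Suc j)) =
     (\<Sum>i\<le>k. \<Sum>j\<le>k. (if j = 0 then 0 else pascal_weight i (j - 1)) * x i * y j)"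
    by (rule sum.cong [OF refl])
      (use sum_weight_shift_index [of y k "\<lambda>j. pascal_weight i j * x i" for i] assms
        in \<open>simp add: if_distrib [of "\<lambda>u. u * _"] cong: if_cong\<close>)
  have "pascal_form k (fdiff x) y + pascal_form k x (fdiff y) =
     (\<Sum>i\<le>k. \<Sum>j\<le>k. pascal_weight i j * x (Suc i) * y j)
     + (\<Sum>i\<le>k. \<Sum>j\<le>k. pascal_weight i j * x i * y (Suc j))
     - 2 * pascal_form k x y"
    by (simp add: pascal_form_def algebra_simps sum.distrib sum_subtractf)
  also have "\<dots> = (\<Sum>i\<le>k. \<Sum>j\<le>k.
     ((if i = 0 then 0 else pascal_weight (i - 1) j) + (if j = 0 then 0 else pascal_weight i (j - 1))
       - 2 * pascal_weight i j) * x i * y j)"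
    unfolding 1 2 pascal_form_def
    by (simp only: sum.distrib sum_subtractf sum_distrib_left distrib_right left_diff_distrib mult.assoc)
  also have "\<dots> = (\<Sum>i\<le>k. \<Sum>j\<le>k. if i = 0 then if j = 0 then - 2 * x 0 * y 0 else 0 else 0)"
    unfolding pascal_weight_lyapunov by (intro sum.cong refl) auto
  also have "\<dots> = (\<Sum>i\<le>k. if i = 0 then - 2 * x 0 * y 0 else 0)"
    by (intro sum.cong refl) (auto simp: sum.delta)
  finally show ?thesis by (simp add: sum.delta)
qed

text \<open>Injectivity of a triangular matrix with nonzero diagonal: for the largest index
  \<open>l\<close> in the support of \<open>v\<close>, the sum reduces to its diagonal term.\<close>

lemma triangular_binomial_sum_nonzero:
  fixes v :: "nat \<Rightarrow> 'a::real_normed_field"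
  assumes "i \<le> k" "v i \<noteq> 0"
  shows "\<exists>l\<le>k. (\<Sum>i\<le>k. of_real (real (i choose l) / 2 ^ i) * v i) \<noteq> 0"
proof -
  define l where "l = Max {i. i \<le> k \<and> v i \<noteq> 0}"
  have fin: "finite {i. i \<le> k \<and> v i \<noteq> 0}" by simp
  have "l \<in> {i. i \<le> k \<and> v i \<noteq> 0}"
    unfolding l_def using assms by (intro Max_in fin) auto
  then have l: "l \<le> k" "v l \<noteq> 0" by auto
  have above: "v i = 0" if "l < i" "i \<le> k" for i
    using Max_ge [OF fin, of i, folded l_def] that by (cases "v i = 0") auto
  have "(\<Sum>i\<le>k. of_real (real (i choose l) / 2 ^ i) * v i)
      = (\<Sum>i\<in>{l}. of_real (real (i choose l) / 2 ^ i) * v i)"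
    using l above by (intro sum.mono_neutral_right) (auto simp: not_less_iff_gr_or_eq binomial_eq_0 neq_iff)
  with l show ?thesis by auto
qed

lemma pascal_hermitian_form:
  fixes v :: "nat \<Rightarrow> complex"
  shows "(\<Sum>i\<le>k. \<Sum>j\<le>k. of_real (pascal_weight i j) * v i * cnj (v j)) =
    of_real (\<Sum>l\<le>k. (cmod (\<Sum>i\<le>k. of_real (real (i choose l) / 2 ^ i) * v i))\<^sup>2)"
proof -
  define c where "c l i = complex_of_real (real (i choose l) / 2 ^ i)" for l i
  have c: "cnj (c l i) = c l i" for l i by (simp add: c_def)
  have "(\<Sum>i\<le>k. \<Sum>j\<le>k. of_real (pascal_weight i j) * v i * cnj (v j)) =
     (\<Sum>i\<le>k. \<Sum>j\<le>k. (\<Sum>l\<le>k. c l i * c l j) * v i * cnj (v j))"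
    by (intro sum.cong refl) (simp add: pascal_weight_factor [of _ k] c_def)
  also have "\<dots> = (\<Sum>i\<le>k. \<Sum>j\<le>k. \<Sum>l\<le>k. (c l i * v i) * cnj (c l j * v j))"
    by (simp add: sum_distrib_right sum_distrib_left c mult_ac)
  also have "\<dots> = (\<Sum>i\<le>k. \<Sum>l\<le>k. \<Sum>j\<le>k. (c l i * v i) * cnj (c l j * v j))"
    by (rule sum.cong [OF refl], rule sum.swap)
  also have "\<dots> = (\<Sum>l\<le>k. \<Sum>i\<le>k. \<Sum>j\<le>k. (c l i * v i) * cnj (c l j * v j))"
    by (rule sum.swap)
  also have "\<dots> = (\<Sum>l\<le>k. of_real ((cmod (\<Sum>i\<le>k. c l i * v i))\<^sup>2))"
    by (simp only: complex_norm_square cnj_sum sum_product)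
  finally show ?thesis by (simp add: c_def)
qed

lemma pascal_hermitian_form_pos:
  fixes v :: "nat \<Rightarrow> complex"
  assumes "i \<le> k" "v i \<noteq> 0"
  shows "Re (\<Sum>i\<le>k. \<Sum>j\<le>k. of_real (pascal_weight i j) * v i * cnj (v j)) > 0"
proof -
  obtain l where "l \<le> k" "(\<Sum>i\<le>k. of_real (real (i choose l) / 2 ^ i) * v i) \<noteq> 0"
    using triangular_binomial_sum_nonzero [of i k v] assms by blast
  then have "(\<Sum>l\<le>k. (cmod (\<Sum>i\<le>k. of_real (real (i choose l) / 2 ^ i) * v i))\<^sup>2) > 0"
    by (intro sum_pos2 [of _ l]) auto
  then show ?thesis unfolding pascal_hermitian_form by simp
qed

lemma pascal_form_pos:
  assumes "i \<le> k" "x i \<noteq> 0"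
  shows "pascal_form k x x > 0"
  using pascal_hermitian_form_pos [of i k "\<lambda>i. of_real (x i)"] assms
  by (simp add: pascal_form_def)

section \<open>Iterated forward differences and seeds with prescribed differences at 0\<close>

lemma funpow_fdiff_eq_0:
  fixes x :: "nat \<Rightarrow> 'a::ab_group_add"
  assumes "\<And>i. k < i \<Longrightarrow> x i = 0" "k < i"
  shows "(fdiff ^^ j) x i = 0"
  using assms(2) by (induction j arbitrary: i) (auto simp: assms(1))

text \<open>Newton's forward difference formula. One difference shifts the sequence
  \<open>c\<close>, so the induction has to vary both \<open>x\<close> and \<open>c\<close>.\<close>

lemma funpow_fdiff_newton:
  fixes x c :: "nat \<Rightarrow> 'a::comm_ring_1"
  assumes "\<And>i. i \<le> j \<Longrightarrow> x i = (\<Sum>l\<le>i. of_nat (i choose l) * c l)"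
  shows "(fdiff ^^ j) x 0 = c j"
  using assms
proof (induction j arbitrary: x c)
  case (Suc j)
  have "(fdiff ^^ j) (fdiff x) 0 = c (Suc j)"
  proof (rule Suc.IH)
    fix i assume "i \<le> j"
    have "x (Suc i) = c 0 + (\<Sum>l\<le>i. of_nat (Suc i choose Suc l) * c (Suc l))"
      using Suc.prems [of "Suc i"] \<open>i \<le> j\<close> by (simp add: sum.atMost_Suc_shift del: sum.atMost_Suc)
    \<comment> \<open>Pascal's rule splits the sum: the bracket reassembles to \<open>x i\<close>,
      and the rest is the Newton series with shifted coefficients.\<close>
    also have "\<dots> = (c 0 + (\<Sum>l\<le>i. of_nat (i choose Suc l) * c (Suc l))) + (\<Sum>l\<le>i. of_nat (i choose l) * c (Suc l))"
      by (simp add: sum.distrib algebra_simps)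
    also have "c 0 + (\<Sum>l\<le>i. of_nat (i choose Suc l) * c (Suc l)) = (\<Sum>l\<le>Suc i. of_nat (i choose l) * c l)"
      by (simp add: sum.atMost_Suc_shift del: sum.atMost_Suc)
    also have "\<dots> = x i"
      using Suc.prems [of i] \<open>i \<le> j\<close> by (simp add: binomial_eq_0)
    finally show "fdiff x i = (\<Sum>l\<le>i. of_nat (i choose l) * c (Suc l))" by simp
  qed
  then show ?case unfolding funpow_Suc_right o_apply .
qed auto

lemma continuous_on_funpow_fdiff:
  fixes x :: "real \<Rightarrow> nat \<Rightarrow> real"
  assumes "\<And>i. continuous_on S (\<lambda>\<tau>. x \<tau> i)"
  shows "continuous_on S (\<lambda>\<tau>. (fdiff ^^ j) (x \<tau>) i)"
  by (induction j arbitrary: i) (auto intro!: continuous_intros assms)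

lemma pascal_form_sum:
  "pascal_form k (\<lambda>i. \<Sum>a\<in>A. e a * X a i) (\<lambda>i. \<Sum>b\<in>A. e b * X b i)
    = (\<Sum>a\<in>A. \<Sum>b\<in>A. e a * e b * pascal_form k (X a) (X b))"
proof -
  have "pascal_form k (\<lambda>i. \<Sum>a\<in>A. e a * X a i) (\<lambda>i. \<Sum>b\<in>A. e b * X b i)
     = (\<Sum>i\<le>k. \<Sum>j\<le>k. \<Sum>a\<in>A. \<Sum>b\<in>A. e a * e b * (pascal_weight i j * X a i * X b j))"
    unfolding pascal_form_def mult.assoc sum_product
    by (simp add: sum_distrib_left mult_ac)
  also have "\<dots> = (\<Sum>i\<le>k. \<Sum>a\<in>A. \<Sum>j\<le>k. \<Sum>b\<in>A. e a * e b * (pascal_weight i j * X a i * X b j))"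
    by (rule sum.cong [OF refl], rule sum.swap)
  also have "\<dots> = (\<Sum>a\<in>A. \<Sum>i\<le>k. \<Sum>j\<le>k. \<Sum>b\<in>A. e a * e b * (pascal_weight i j * X a i * X b j))"
    by (rule sum.swap)
  also have "\<dots> = (\<Sum>a\<in>A. \<Sum>i\<le>k. \<Sum>b\<in>A. \<Sum>j\<le>k. e a * e b * (pascal_weight i j * X a i * X b j))"
    by (rule sum.cong [OF refl], rule sum.cong [OF refl], rule sum.swap)
  also have "\<dots> = (\<Sum>a\<in>A. \<Sum>b\<in>A. \<Sum>i\<le>k. \<Sum>j\<le>k. e a * e b * (pascal_weight i j * X a i * X b j))"
    by (rule sum.cong [OF refl], rule sum.swap)
  finally show ?thesis by (simp add: pascal_form_def sum_distrib_left)
qed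

text \<open>The Newton series whose differences at 0 are \<open>q j * \<tau> ^ (k - j)\<close>, cut
  off after \<open>k\<close> so that it represents a vector of length \<open>k + 1\<close>. These
  exponents make \<open>(\<tau> * s) ^ j\<close> times the difference of order \<open>j\<close> a
  multiple of \<open>\<tau> ^ k\<close>.\<close>

definition diff_seed :: "(nat \<Rightarrow> real) \<Rightarrow> nat \<Rightarrow> real \<Rightarrow> nat \<Rightarrow> real" where
  "diff_seed q k \<tau> i = (if i \<le> k then \<Sum>j\<le>i. real (i choose j) * (q j * \<tau> ^ (k - j)) else 0)"

lemma funpow_fdiff_seed_0: "j \<le> k \<Longrightarrow> (fdiff ^^ j) (diff_seed q k \<tau>) 0 = q j * \<tau> ^ (k - j)"
  by (rule funpow_fdiff_newton) (simp add: diff_seed_def)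

lemma funpow_fdiff_seed_eq_0: "k < i \<Longrightarrow> (fdiff ^^ j) (diff_seed q k \<tau>) i = 0"
  by (rule funpow_fdiff_eq_0) (auto simp: diff_seed_def)

lemma pascal_form_funpow_fdiff_seed:
  fixes q k \<tau>
  defines "G \<equiv> \<lambda>i j. pascal_form k ((fdiff ^^ i) (diff_seed q k \<tau>)) ((fdiff ^^ j) (diff_seed q k \<tau>))"
  shows "G (Suc i) j + G i (Suc j) = - 2 * (fdiff ^^ i) (diff_seed q k \<tau>) 0 * (fdiff ^^ j) (diff_seed q k \<tau>) 0"
  unfolding G_def funpow.simps(2) o_apply
  by (rule pascal_form_fdiff) (auto intro: funpow_fdiff_seed_eq_0)

lemma continuous_on_funpow_fdiff_seed:
  "continuous_on S (\<lambda>\<tau>. (fdiff ^^ j) (diff_seed q k \<tau>) i)"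
proof (rule continuous_on_funpow_fdiff)
  show "continuous_on S (\<lambda>\<tau>. diff_seed q k \<tau> i)" for i
    by (cases "i \<le> k") (auto simp: diff_seed_def intro!: continuous_intros)
qed

text \<open>The squared sum in the dissipation is \<open>\<tau> ^ (2 * k)\<close> times a continuous
  function, of which \<open>\<tau> ^ p\<close> is split off. Hence the factor
  \<open>0 ^ (2 * k - p)\<close> in the limit: the dissipation counts if \<open>p = 2 * k\<close>
  and disappears if \<open>p < 2 * k\<close>.\<close>

lemma pascal_energy_increase:
  assumes "k \<le> p" "p \<le> 2 * k"
    and neg: "0 ^ (2 * k - p) * integral {0..1} (\<lambda>s. (\<Sum>j\<le>k. s ^ j / fact j * q j)\<^sup>2)
      + pascal_form k (diff_seed q k 0) ((fdiff ^^ Suc p) (diff_seed q k 0)) / fact (Suc p) < 0"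
  shows "\<forall>\<^sub>F \<tau> in at_right 0. pascal_form k (diff_seed q k \<tau>) (diff_seed q k \<tau>)
    < pascal_form k (\<lambda>i. \<Sum>j\<le>p. \<tau> ^ j / fact j * (fdiff ^^ j) (diff_seed q k \<tau>) i)
        (\<lambda>i. \<Sum>j\<le>p. \<tau> ^ j / fact j * (fdiff ^^ j) (diff_seed q k \<tau>) i)"
proof -
  define G where "G \<tau> i j = pascal_form k ((fdiff ^^ i) (diff_seed q k \<tau>)) ((fdiff ^^ j) (diff_seed q k \<tau>))" for \<tau> i j
  define y where "y \<tau> j = (fdiff ^^ j) (diff_seed q k \<tau>) 0" for \<tau> j
  \<comment> \<open>Differences of order \<open>j > k\<close> are not prescribed, but they carry the
    surplus power \<open>\<tau> ^ (j - k)\<close> and drop out at \<open>\<tau> = 0\<close>.\<close>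
  define W where "W \<tau> s = (\<Sum>j\<le>p. if j \<le> k then s ^ j / fact j * q j
     else s ^ j / fact j * (\<tau> ^ (j - k) * y \<tau> j))" for \<tau> s :: real
  define Z where "Z \<tau> s = \<tau> ^ (2 * k - p) * (W \<tau> s)\<^sup>2" for \<tau> s
  have W: "(\<Sum>j\<le>p. (\<tau> * s) ^ j / fact j * y \<tau> j) = \<tau> ^ k * W \<tau> s" for \<tau> s
    unfolding W_def sum_distrib_left
  proof (intro sum.cong refl)
    fix j
    show "(\<tau> * s) ^ j / fact j * y \<tau> j = \<tau> ^ k * (if j \<le> k then s ^ j / fact j * q j
      else s ^ j / fact j * (\<tau> ^ (j - k) * y \<tau> j))"
    proof (cases "j \<le> k")
      case True
      then have "\<tau> ^ k = \<tau> ^ (k - j) * \<tau> ^ j" by (simp flip: power_add)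
      with True show ?thesis by (simp add: y_def funpow_fdiff_seed_0 power_mult_distrib)
    next
      case False
      then have "\<tau> ^ j = \<tau> ^ k * \<tau> ^ (j - k)" by (simp flip: power_add)
      with False show ?thesis by (simp add: power_mult_distrib)
    qed
  qed
  have conty: "continuous_on UNIV (\<lambda>x. y (fst x) j)" for j
    unfolding y_def by (rule continuous_on_compose2 [OF continuous_on_funpow_fdiff_seed])
      (auto intro!: continuous_intros)
  have "continuous_on UNIV (\<lambda>x. if j \<le> k then snd x ^ j / fact j * q j
     else snd x ^ j / fact j * (fst x ^ (j - k) * y (fst x) j))" for j
    by (cases "j \<le> k") (auto intro!: continuous_intros conty)
  then have contZ: "continuous_on UNIV (\<lambda>(\<tau>, s). Z \<tau> s)"
    unfolding Z_def W_def case_prod_beta by (intro continuous_intros)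
  have W0: "W 0 s = (\<Sum>j\<le>k. s ^ j / fact j * q j)" for s
    unfolding W_def using assms(1) by (intro sum.mono_neutral_cong_right) auto
  have "\<forall>\<^sub>F \<tau> in at_right 0. G \<tau> 0 0 < (\<Sum>i\<le>p. \<Sum>j\<le>p. \<tau> ^ i / fact i * (\<tau> ^ j / fact j) * G \<tau> i j)"
  proof (rule energy_increase)
    show "G \<tau> i j = G \<tau> j i" for \<tau> i j
      by (simp add: G_def pascal_form_sym)
    show "G \<tau> (Suc i) j + G \<tau> i (Suc j) = - 2 * y \<tau> i * y \<tau> j" for \<tau> i j
      unfolding G_def y_def by (rule pascal_form_funpow_fdiff_seed)
    show "continuous_on UNIV (\<lambda>\<tau>. G \<tau> i (Suc p))" for i
      unfolding G_def pascal_form_def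
      by (intro continuous_intros continuous_on_funpow_fdiff_seed)
    show "(\<Sum>i\<le>p. (\<tau> * s) ^ i / fact i * y \<tau> i)\<^sup>2 = \<tau> ^ p * Z \<tau> s" for \<tau> s
    proof -
      have "\<tau> ^ (2 * k) = \<tau> ^ p * \<tau> ^ (2 * k - p)"
        using assms(2) by (simp flip: power_add)
      then show ?thesis unfolding W Z_def
        by (simp add: power_mult_distrib mult.commute flip: power_mult)
    qed
    show "integral {0..1} (Z 0) + G 0 0 (Suc p) / fact (Suc p) < 0"
      using neg unfolding Z_def W0 G_def by simp
  qed (fact contZ)
  then show ?thesis unfolding G_def pascal_form_sum by simp
qed

text \<open>All \<open>k\<close> sign changes of \<open>gram_alternating\<close> are used. At
  \<open>\<tau> = 0\<close> the assumption holds for every \<open>q\<close>, since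
  \<open>0 ^ (k - j) = 0\<close> for \<open>j < k\<close>.\<close>

lemma diff_seed_energy_moment:
  assumes "\<And>j. j < k \<Longrightarrow> (fdiff ^^ j) (diff_seed q k \<tau>) 0 = 0"
  shows "pascal_form k (diff_seed q k \<tau>) ((fdiff ^^ (k + r)) (diff_seed q k \<tau>)) =
    (-1) ^ k * pascal_form k ((fdiff ^^ k) (diff_seed q k \<tau>)) ((fdiff ^^ r) (diff_seed q k \<tau>))"
  using gram_alternating [of "\<lambda>i j. pascal_form k ((fdiff ^^ i) (diff_seed q k \<tau>)) ((fdiff ^^ j) (diff_seed q k \<tau>))",
      OF pascal_form_funpow_fdiff_seed [where k = k and q = q and \<tau> = \<tau>] assms order_refl] by simp

lemma exists_pascal_energy_increase:
  assumes "(\<exists>m\<ge>1. p = 4 * m) \<or> (\<exists>m. p = 4 * m + 1)"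
  shows "\<exists>k q. \<forall>\<^sub>F \<tau> in at_right 0. pascal_form k (diff_seed q k \<tau>) (diff_seed q k \<tau>)
    < pascal_form k (\<lambda>i. \<Sum>j\<le>p. \<tau> ^ j / fact j * (fdiff ^^ j) (diff_seed q k \<tau>) i)
        (\<lambda>i. \<Sum>j\<le>p. \<tau> ^ j / fact j * (fdiff ^^ j) (diff_seed q k \<tau>) i)"
  using assms
proof
  assume "\<exists>m\<ge>1. p = 4 * m"
  then obtain m where m: "m \<ge> 1" "p = 4 * m" by blast
  define k where "k = 2 * m"
  obtain q where q: "(q k)\<^sup>2 = (fact k)\<^sup>2"
    "integral {0..1} (\<lambda>s. (\<Sum>j\<le>k. s ^ j / fact j * q j)\<^sup>2) < (fact k)\<^sup>2 / (fact (Suc p) :: real)"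
    using exists_small_polynomial [OF m(1)] m(2) by (auto simp: k_def)
  define x where "x = diff_seed q k 0"
  have "pascal_form k x ((fdiff ^^ Suc p) x) = (-1) ^ k * pascal_form k ((fdiff ^^ k) x) ((fdiff ^^ Suc k) x)"
    using diff_seed_energy_moment [of k q 0 "Suc k"] by (simp add: x_def k_def m(2) funpow_fdiff_seed_0)
  \<comment> \<open>The Lyapunov relation at \<open>i = j = k\<close>; the difference of order
    \<open>k\<close> at 0 is \<open>q k * 0 ^ 0 = q k\<close>.\<close>
  also have "2 * pascal_form k ((fdiff ^^ k) x) ((fdiff ^^ Suc k) x) = - 2 * (q k)\<^sup>2"
    using pascal_form_funpow_fdiff_seed [where k = k and i = k and j = k and q = q and \<tau> = 0]
    by (simp add: x_def pascal_form_sym [of k "(fdiff ^^ Suc k) _"] funpow_fdiff_seed_0 power2_eq_square del: funpow.simps)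
  then have "pascal_form k ((fdiff ^^ k) x) ((fdiff ^^ Suc k) x) = - (fact k)\<^sup>2"
    using q(1) by linarith
  finally have "pascal_form k x ((fdiff ^^ Suc p) x) = - (fact k)\<^sup>2"
    by (simp add: k_def)
  \<comment> \<open>Here \<open>0 ^ (2 * k - p) = 1\<close>: the dissipation counts, and the strict
    bound on the integral keeps it below the gain.\<close>
  then have "\<forall>\<^sub>F \<tau> in at_right 0. pascal_form k (diff_seed q k \<tau>) (diff_seed q k \<tau>)
    < pascal_form k (\<lambda>i. \<Sum>j\<le>p. \<tau> ^ j / fact j * (fdiff ^^ j) (diff_seed q k \<tau>) i)
        (\<lambda>i. \<Sum>j\<le>p. \<tau> ^ j / fact j * (fdiff ^^ j) (diff_seed q k \<tau>) i)"
    using q(2) m unfolding x_def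
    by (intro pascal_energy_increase) (auto simp: k_def simp del: fact_Suc funpow.simps)
  then show ?thesis by blast
next
  assume "\<exists>m. p = 4 * m + 1"
  then obtain m where m: "p = 4 * m + 1" by blast
  define k where "k = 2 * m + 1"
  define q :: "nat \<Rightarrow> real" where "q j = (if j = k then 1 else 0)" for j
  define x where "x = diff_seed q k 0"
  have "pascal_form k x ((fdiff ^^ Suc p) x) = (-1) ^ k * pascal_form k ((fdiff ^^ k) x) ((fdiff ^^ k) x)"
  proof -
    have "k + k = Suc p" by (simp add: k_def m)
    then show ?thesis
      using diff_seed_energy_moment [of k q 0 k] by (simp add: x_def q_def funpow_fdiff_seed_0 del: funpow.simps)
  qed
  \<comment> \<open>The difference of order \<open>k\<close> does not vanish, as its value at 0 is
    \<open>q k = 1\<close>.\<close>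
  moreover have "pascal_form k ((fdiff ^^ k) x) ((fdiff ^^ k) x) > 0"
    by (rule pascal_form_pos [of 0]) (simp_all add: x_def funpow_fdiff_seed_0 q_def)
  ultimately have "pascal_form k x ((fdiff ^^ Suc p) x) < 0"
    by (simp add: k_def)
  \<comment> \<open>Now \<open>2 * k - p = 1\<close>, so the integral is multiplied by 0 and the
    negative moment alone decides.\<close>
  then have "\<forall>\<^sub>F \<tau> in at_right 0. pascal_form k (diff_seed q k \<tau>) (diff_seed q k \<tau>)
    < pascal_form k (\<lambda>i. \<Sum>j\<le>p. \<tau> ^ j / fact j * (fdiff ^^ j) (diff_seed q k \<tau>) i)
        (\<lambda>i. \<Sum>j\<le>p. \<tau> ^ j / fact j * (fdiff ^^ j) (diff_seed q k \<tau>) i)"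
    unfolding x_def using m
    by (intro pascal_energy_increase) (auto simp: k_def divide_neg_pos simp del: fact_Suc funpow.simps)
  then show ?thesis by blast
qed

section \<open>Stability coefficients of explicit Runge--Kutta schemes\<close>

lemma pow_mat_mult_vec:
  assumes "A \<in> carrier_mat n n" "u \<in> carrier_vec n"
  shows "(A ^\<^sub>m j) *\<^sub>v u = ((*\<^sub>v) A ^^ j) u"
  using assms(2)
proof (induction j arbitrary: u)
  case (Suc j)
  have "(A ^\<^sub>m Suc j) *\<^sub>v u = (A ^\<^sub>m j) *\<^sub>v (A *\<^sub>v u)"
    using assms(1) Suc.prems by (simp add: assoc_mult_mat_vec [of _ n n _ n])
  also have "\<dots> = ((*\<^sub>v) A ^^ j) (A *\<^sub>v u)"
    using assms(1) Suc.prems by (intro Suc.IH) simp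
  finally show ?case unfolding funpow_Suc_right o_apply .
qed (use assms in simp)

lemma funpow_mult_mat_vec_carrier:
  assumes "A \<in> carrier_mat n n" "u \<in> carrier_vec n"
  shows "((*\<^sub>v) A ^^ j) u \<in> carrier_vec n"
  using assms by (induction j) auto

lemma mult_mat_vec_sum:
  fixes A :: "'a::comm_semiring_0 mat"
  assumes "A \<in> carrier_mat n n" "\<And>l. l \<in> I \<Longrightarrow> X l \<in> carrier_vec n"
  shows "A *\<^sub>v vec n (\<lambda>k. \<Sum>l\<in>I. c l * X l $ k) = vec n (\<lambda>k. \<Sum>l\<in>I. c l * (A *\<^sub>v X l) $ k)"
proof (rule eq_vecI)
  fix k assume "k < dim_vec (vec n (\<lambda>k. \<Sum>l\<in>I. c l * (A *\<^sub>v X l) $ k))"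
  then have k: "k < n" by simp
  have "(A *\<^sub>v vec n (\<lambda>k. \<Sum>l\<in>I. c l * X l $ k)) $ k
      = (\<Sum>i = 0..<n. \<Sum>l\<in>I. A $$ (k, i) * (c l * X l $ i))"
    using assms(1) k by (simp add: scalar_prod_def sum_distrib_left)
  also have "\<dots> = (\<Sum>l\<in>I. \<Sum>i = 0..<n. A $$ (k, i) * (c l * X l $ i))"
    by (rule sum.swap)
  also have "\<dots> = (\<Sum>l\<in>I. c l * (A *\<^sub>v X l) $ k)"
    using assms(1) k
    by (intro sum.cong refl) (auto simp: carrier_vecD [OF assms(2)] scalar_prod_def sum_distrib_left mult_ac)
  finally show "(A *\<^sub>v vec n (\<lambda>k. \<Sum>l\<in>I. c l * X l $ k)) $ k = vec n (\<lambda>k. \<Sum>l\<in>I. c l * (A *\<^sub>v X l) $ k) $ k"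
    using k by simp
qed (use assms in auto)

text \<open>Component \<open>i\<close> of A^l applied to the all-ones vector, where A is the
  strictly lower triangular matrix of the \<open>a i j\<close>.\<close>

primrec rk_coeff :: "(nat \<Rightarrow> nat \<Rightarrow> real) \<Rightarrow> nat \<Rightarrow> nat \<Rightarrow> real" where
  "rk_coeff a 0 = (\<lambda>i. 1)"
| "rk_coeff a (Suc l) = (\<lambda>i. \<Sum>j\<in>{1..<i}. a i j * rk_coeff a l j)"

text \<open>Nilpotency of A: each factor makes one further leading component vanish.\<close>

lemma rk_coeff_eq_0: "1 \<le> i \<Longrightarrow> i \<le> l \<Longrightarrow> rk_coeff a l i = 0"
  by (induction l arbitrary: i) (auto intro!: sum.neutral)

text \<open>Unrolling the stage recursion gives the Neumann series in \<tau> L and A, finite by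
  nilpotency. A common bound \<open>N\<close> lets all stages share one summation range.\<close>

lemma rk_stage_eq:
  assumes L: "L \<in> carrier_mat n n" and u: "u \<in> carrier_vec n" and "1 \<le> i" "i \<le> N"
  shows "rk_stage a L \<tau> u i = vec n (\<lambda>k. \<Sum>l<N. complex_of_real (rk_coeff a l i * \<tau> ^ l) * ((*\<^sub>v) L ^^ Suc l) u $ k)"
  using assms(3,4)
proof (induction i rule: less_induct)
  case (less i)
  let ?X = "\<lambda>l. ((*\<^sub>v) L ^^ l) u"
  have arg: "u + complex_of_real \<tau> \<cdot>\<^sub>v
       vec (dim_vec u) (\<lambda>k. \<Sum>j\<in>{1..<i}. complex_of_real (a i j) * rk_stage a L \<tau> u j $ k)
     = vec n (\<lambda>k. \<Sum>l<N. complex_of_real (rk_coeff a l i * \<tau> ^ l) * ?X l $ k)" (is "?l = ?r")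
  proof (rule eq_vecI)
    fix k assume "k < dim_vec ?r"
    then have k: "k < n" by simp
    have "(\<Sum>j\<in>{1..<i}. complex_of_real (a i j) * rk_stage a L \<tau> u j $ k)
       = (\<Sum>j\<in>{1..<i}. \<Sum>l<N. complex_of_real (a i j * rk_coeff a l j * \<tau> ^ l) * ?X (Suc l) $ k)"
      using less k by (intro sum.cong refl) (simp add: sum_distrib_left mult.assoc)
    also have "\<dots> = (\<Sum>l<N. \<Sum>j\<in>{1..<i}. complex_of_real (a i j * rk_coeff a l j * \<tau> ^ l) * ?X (Suc l) $ k)"
      by (rule sum.swap)
    also have "\<dots> = (\<Sum>l<N. complex_of_real (rk_coeff a (Suc l) i * \<tau> ^ l) * ?X (Suc l) $ k)"
      by (simp add: sum_distrib_right)
    finally have "?l $ k = complex_of_real (rk_coeff a 0 i * \<tau> ^ 0) * ?X 0 $ k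
        + (\<Sum>l<N. complex_of_real (rk_coeff a (Suc l) i * \<tau> ^ Suc l) * ?X (Suc l) $ k)"
      using u k by (simp add: sum_distrib_left mult_ac del: rk_coeff.simps(2) funpow.simps(2))
    also have "\<dots> = (\<Sum>l\<le>N. complex_of_real (rk_coeff a l i * \<tau> ^ l) * ?X l $ k)"
      by (simp only: sum.atMost_shift)
    \<comment> \<open>The shift has produced the index \<open>N\<close>, whose coefficient is zero
      because \<open>i \<le> N\<close>.\<close>
    also have "\<dots> = ?r $ k"
      using k less.prems by (simp add: lessThan_Suc_atMost [symmetric] rk_coeff_eq_0)
    finally show "?l $ k = ?r $ k" .
  qed (use u in auto)
  show ?case
    unfolding rk_stage.simps [of a L \<tau> u i] arg
    using L u by (simp add: mult_mat_vec_sum [OF L] funpow_mult_mat_vec_carrier)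
qed

text \<open>The coefficients of R(z) = 1 + z b^T (I - z A)^(-1) 1, that is, b^T A^(l-1) 1 for
  \<open>l \<ge> 1\<close>.\<close>

definition rk_stability_coeff :: "(nat \<Rightarrow> nat \<Rightarrow> real) \<Rightarrow> (nat \<Rightarrow> real) \<Rightarrow> nat \<Rightarrow> nat \<Rightarrow> real" where
  "rk_stability_coeff a b s l = (case l of 0 \<Rightarrow> 1 | Suc l \<Rightarrow> \<Sum>i\<in>{1..s}. b i * rk_coeff a l i)"

lemma rk_step_eq:
  assumes L: "L \<in> carrier_mat n n" and u: "u \<in> carrier_vec n"
  shows "rk_step a b s L \<tau> u =
    vec n (\<lambda>k. \<Sum>l\<le>s. complex_of_real (rk_stability_coeff a b s l * \<tau> ^ l) * ((*\<^sub>v) L ^^ l) u $ k)" (is "?l = ?r")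
proof (rule eq_vecI)
  let ?X = "\<lambda>l. ((*\<^sub>v) L ^^ l) u"
  fix k assume "k < dim_vec ?r"
  then have k: "k < n" by simp
  have "(\<Sum>i\<in>{1..s}. complex_of_real (b i) * rk_stage a L \<tau> u i $ k)
     = (\<Sum>i\<in>{1..s}. \<Sum>l<s. complex_of_real (b i * rk_coeff a l i * \<tau> ^ l) * ?X (Suc l) $ k)"
    using k by (intro sum.cong refl) (simp add: rk_stage_eq [OF L u, of _ s] sum_distrib_left mult.assoc)
  also have "\<dots> = (\<Sum>l<s. \<Sum>i\<in>{1..s}. complex_of_real (b i * rk_coeff a l i * \<tau> ^ l) * ?X (Suc l) $ k)"
    by (rule sum.swap)
  also have "\<dots> = (\<Sum>l<s. complex_of_real (rk_stability_coeff a b s (Suc l) * \<tau> ^ l) * ?X (Suc l) $ k)"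
    by (simp add: rk_stability_coeff_def sum_distrib_right)
  finally have "?l $ k = complex_of_real (rk_stability_coeff a b s 0 * \<tau> ^ 0) * ?X 0 $ k
      + (\<Sum>l<s. complex_of_real (rk_stability_coeff a b s (Suc l) * \<tau> ^ Suc l) * ?X (Suc l) $ k)"
    using u k by (simp add: rk_step_def rk_stability_coeff_def [of _ _ _ 0] sum_distrib_left mult_ac del: funpow.simps(2))
  also have "\<dots> = ?r $ k"
    using k by (simp only: sum.atMost_shift index_vec)
  finally show "?l $ k = ?r $ k" .
qed (use u in \<open>auto simp: rk_step_def\<close>)

section \<open>Asymptotics at 0 and the order conditions\<close>

lemma eventually_power_nonzero: "\<forall>\<^sub>F t in at_right (0::real). t ^ l \<noteq> 0"
  by (rule eventually_mono [OF eventually_at_right_less]) simp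

lemma power_smallo_power:
  assumes "l < m"
  shows "(\<lambda>t::real. t ^ m) \<in> o[at_right 0](\<lambda>t. t ^ l)"
proof (rule smalloI_tendsto)
  have "((\<lambda>t::real. t ^ (m - l)) \<longlongrightarrow> 0 ^ (m - l)) (at_right 0)"
    by (intro tendsto_intros)
  then have "((\<lambda>t::real. t ^ (m - l)) \<longlongrightarrow> 0) (at_right 0)"
    using assms by (simp add: power_0_left)
  then show "((\<lambda>t::real. t ^ m / t ^ l) \<longlongrightarrow> 0) (at_right 0)"
    by (rule Lim_transform_eventually)
      (use assms in \<open>auto intro!: eventually_mono [OF eventually_at_right_less] simp: power_diff\<close>)
qed (fact eventually_power_nonzero)

text \<open>Once the lower coefficients vanish, \<open>d l * t ^ l\<close> is the whole sum minus
  higher powers. Both are o(\<open>t ^ l\<close>), which a nonzero multiple of \<open>t ^ l\<close>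
  is not.\<close>

lemma polynomial_bigo_imp_zero:
  fixes d :: "nat \<Rightarrow> real"
  assumes "(\<lambda>t. \<Sum>l\<le>p. d l * t ^ l) \<in> O[at_right 0](\<lambda>t. t ^ Suc p)" "l \<le> p"
  shows "d l = 0"
  using assms(2)
proof (induction l rule: less_induct)
  case (less l)
  have "(\<Sum>m\<le>p. d m * t ^ m) - (\<Sum>m\<in>{l<..p}. d m * t ^ m) = d l * t ^ l" for t
  proof -
    have "(\<Sum>m\<le>p. d m * t ^ m) = (\<Sum>m\<in>insert l {l<..p}. d m * t ^ m)"
      using less by (intro sum.mono_neutral_right) (auto simp: not_less_iff_gr_or_eq)
    then show ?thesis by simp
  qed
  moreover have "(\<lambda>t. \<Sum>l\<le>p. d l * t ^ l) \<in> o[at_right 0](\<lambda>t. t ^ l)"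
    using assms(1) power_smallo_power [of l "Suc p"] less.prems
    by (auto intro: landau_o.big_small_trans)
  moreover have "(\<lambda>t. \<Sum>m\<in>{l<..p}. d m * t ^ m) \<in> o[at_right 0](\<lambda>t. t ^ l)"
    by (rule big_sum_in_smallo) (auto intro!: power_smallo_power)
  ultimately have small: "(\<lambda>t. d l * t ^ l) \<in> o[at_right 0](\<lambda>t. t ^ l)"
    by (metis (no_types, lifting) ext sum_in_smallo(2))
  show ?case
  proof (rule ccontr)
    assume "d l \<noteq> 0"
    with small have "(\<lambda>t::real. t ^ l) \<in> o[at_right 0](\<lambda>t. t ^ l)"
      by simp
    then have "\<forall>\<^sub>F t in at_right (0::real). t ^ l = 0"
      by (simp only: landau_o.small_refl_iff)
    with eventually_power_nonzero [of l] have "\<forall>\<^sub>F t in at_right (0::real). False"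
      by eventually_elim simp
    then show False by simp
  qed
qed

lemma exp_taylor_bigo:
  "(\<lambda>t::real. exp t - (\<Sum>l\<le>p. t ^ l / fact l)) \<in> O[at_right 0](\<lambda>t. t ^ Suc p)"
proof (rule bigoI)
  \<comment> \<open>For \<open>t\<close> in (0, 1) the intermediate point of the Lagrange remainder
    is below 1, so \<open>exp 1\<close> bounds its exponential uniformly.\<close>
  have "eventually (\<lambda>t::real. t \<in> {0<..<1}) (at_right 0)"
    by (rule eventually_at_right_real) simp
  then show "\<forall>\<^sub>F t in at_right (0::real). norm (exp t - (\<Sum>l\<le>p. t ^ l / fact l)) \<le> exp 1 / fact (Suc p) * norm (t ^ Suc p)"
  proof eventually_elim
    case (elim t)
    obtain x where x: "\<bar>x\<bar> \<le> \<bar>t\<bar>" "exp t = (\<Sum>m<Suc p. t ^ m / fact m) + exp x / fact (Suc p) * t ^ Suc p"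
      using Maclaurin_exp_le [of t "Suc p"] by blast
    then have "norm (exp t - (\<Sum>l\<le>p. t ^ l / fact l)) = exp x / fact (Suc p) * norm (t ^ Suc p)"
      by (simp add: lessThan_Suc_atMost abs_mult)
    also have "\<dots> \<le> exp 1 / fact (Suc p) * norm (t ^ Suc p)"
      using x elim by (intro mult_right_mono divide_right_mono) auto
    finally show ?case .
  qed
qed

text \<open>The scalar equation u' = u suffices as a test: one step is the polynomial R(\<tau>), the
  solution is exp \<tau>, and agreement up to order p + 1 fixes every coefficient, as R has degree
  at most p.\<close>

lemma rk_linear_order_imp_stability_coeff:
  assumes "rk_linear_order a b p p" "l \<le> p"
  shows "rk_stability_coeff a b p l = 1 / fact l"
proof -
  define L :: "complex mat" where "L = 1\<^sub>m 1"
  define u0 :: "complex vec" where "u0 = vec 1 (\<lambda>_. 1)"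
  define u :: "real \<Rightarrow> complex vec" where "u t = vec 1 (\<lambda>_. of_real (exp t))" for t
  have L: "L \<in> carrier_mat 1 1" and u0: "u0 \<in> carrier_vec 1"
    by (auto simp: L_def u0_def)
  have "((\<lambda>t. complex_of_real (exp t)) has_vector_derivative complex_of_real (exp t)) (at t within {0..})" for t :: real
    by (auto intro!: derivative_eq_intros has_vector_derivative_of_real simp flip: has_real_derivative_iff_has_vector_derivative)
  then have "linear_ivp_solution 1 L u0 u"
    by (auto simp: linear_ivp_solution_def L_def u_def u0_def)
  with assms(1) L u0 have "(\<lambda>\<tau>. cmod (rk_step a b p L \<tau> u0 $ 0 - u \<tau> $ 0)) \<in> O[at_right 0](\<lambda>\<tau>. \<tau> ^ (p + 1))"
    unfolding rk_linear_order_def by blast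
  moreover have "((*\<^sub>v) L ^^ l) u0 = u0" for l
    by (induction l) (use u0 in \<open>auto simp: L_def\<close>)
  then have "rk_step a b p L \<tau> u0 $ 0 - u \<tau> $ 0 = of_real ((\<Sum>l\<le>p. rk_stability_coeff a b p l * \<tau> ^ l) - exp \<tau>)" for \<tau>
    by (simp add: rk_step_eq [OF L u0] u_def) (simp add: u0_def)
  ultimately have "(\<lambda>\<tau>. (\<Sum>l\<le>p. rk_stability_coeff a b p l * \<tau> ^ l) - exp \<tau>) \<in> O[at_right 0](\<lambda>\<tau>. \<tau> ^ Suc p)"
    by (simp only: norm_of_real landau_o.big.abs_in_iff Suc_eq_plus1)
  from sum_in_bigo(1) [OF this exp_taylor_bigo]
  have "(\<lambda>\<tau>. \<Sum>l\<le>p. (rk_stability_coeff a b p l - 1 / fact l) * \<tau> ^ l) \<in> O[at_right 0](\<lambda>\<tau>. \<tau> ^ Suc p)"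
    by (simp add: left_diff_distrib sum_subtractf)
  from polynomial_bigo_imp_zero [OF this assms(2)] show ?thesis by simp
qed

section \<open>The truncated exponential as stability function\<close>

lemma coeff_truncated_exp: "coeff (truncated_exp p) j = (if j \<le> p then 1 / fact j else 0)"
  by (simp add: truncated_exp_def coeff_sum)

lemma degree_truncated_exp: "degree (truncated_exp p) = p"
  by (rule antisym) (auto intro: degree_le le_degree simp: coeff_truncated_exp)

lemma is_stability_function_truncated_exp:
  assumes "rk_linear_order a b p p"
  shows "is_stability_function a b p (truncated_exp p)"
  unfolding is_stability_function_def
proof (intro allI ballI impI)
  fix n :: nat and L :: "complex mat" and \<tau> :: real and u :: "complex vec"
  assume L: "L \<in> carrier_mat n n" and u: "u \<in> carrier_vec n"
  have smult: "complex_of_real \<tau> \<cdot>\<^sub>m L \<in> carrier_mat n n" using L by simp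
  have "((*\<^sub>v) (complex_of_real \<tau> \<cdot>\<^sub>m L) ^^ j) u = complex_of_real \<tau> ^ j \<cdot>\<^sub>v ((*\<^sub>v) L ^^ j) u" for j
  proof (induction j)
    case (Suc j)
    have "(complex_of_real \<tau> \<cdot>\<^sub>m L) *\<^sub>v (complex_of_real \<tau> ^ j \<cdot>\<^sub>v x) = complex_of_real \<tau> ^ Suc j \<cdot>\<^sub>v (L *\<^sub>v x)"
      if "x \<in> carrier_vec n" for x
      using L that by (intro eq_vecI) (auto simp: scalar_prod_def sum_distrib_left mult_ac)
    with Suc funpow_mult_mat_vec_carrier [OF L u, of j] show ?case by simp
  qed simp
  then show "rk_step a b p L \<tau> u = mat_poly_apply (truncated_exp p) (complex_of_real \<tau> \<cdot>\<^sub>m L) u"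
    using u unfolding mat_poly_apply_def rk_step_eq [OF L u] degree_truncated_exp pow_mat_mult_vec [OF smult u]
    by (intro eq_vecI) (auto intro!: sum.cong simp: coeff_truncated_exp
      rk_linear_order_imp_stability_coeff [OF assms] index_smult_vec
      carrier_vecD [OF funpow_mult_mat_vec_carrier [OF L u]] simp del: funpow.simps)
qed

section \<open>The matrix counterexample\<close>

lemma mat_adjoint_index:
  assumes "A \<in> carrier_mat n n" "i < n" "j < n"
  shows "mat_adjoint A $$ (i, j) = conjugate (A $$ (j, i))"
  using assms by (auto simp: mat_adjoint_def mat_of_rows_index)

lemma mat_adjoint_carrier: "A \<in> carrier_mat n n \<Longrightarrow> mat_adjoint A \<in> carrier_mat n n"
  by (auto simp: mat_adjoint_def)

text \<open>The second factor of \<open>\<bullet>c\<close> is conjugated, so the entries of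
  \<open>M\<close> appear conjugated.\<close>

lemma quadratic_form_eq:
  fixes M :: "complex mat"
  assumes "M \<in> carrier_mat (Suc k) (Suc k)" "v \<in> carrier_vec (Suc k)"
  shows "v \<bullet>c (M *\<^sub>v v) = (\<Sum>i\<le>k. \<Sum>j\<le>k. cnj (M $$ (i, j)) * v $ i * cnj (v $ j))"
  using assms
  by (simp add: scalar_prod_def sum_distrib_left mult_ac atLeast0LessThan lessThan_Suc_atMost
      del: sum.lessThan_Suc)

definition pascal_mat :: "nat \<Rightarrow> complex mat" where
  "pascal_mat k = mat (Suc k) (Suc k) (\<lambda>(i, j). of_real (pascal_weight i j))"

lemma pascal_mat_carrier [simp]: "pascal_mat k \<in> carrier_mat (Suc k) (Suc k)"
  by (simp add: pascal_mat_def)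

lemma pascal_mat_index [simp]:
  "i \<le> k \<Longrightarrow> j \<le> k \<Longrightarrow> pascal_mat k $$ (i, j) = of_real (pascal_weight i j)"
  "dim_row (pascal_mat k) = Suc k"
  "dim_col (pascal_mat k) = Suc k"
  by (simp_all add: pascal_mat_def)

lemma pascal_mat_hermitian: "mat_adjoint (pascal_mat k) = pascal_mat k"
  using mat_adjoint_carrier [OF pascal_mat_carrier, of k]
  by (intro eq_matI) (auto simp: mat_adjoint_index [OF pascal_mat_carrier] pascal_weight_sym)

lemma pos_def_pascal_mat: "pos_def_mat (Suc k) (pascal_mat k)"
  unfolding pos_def_mat_def hermitian_mat_def
proof (intro conjI ballI impI)
  fix v :: "complex vec" assume v: "v \<in> carrier_vec (Suc k)" "v \<noteq> 0\<^sub>v (Suc k)"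
  then obtain i where "i \<le> k" "v $ i \<noteq> 0"
    by (metis carrier_vecD eq_vecI index_zero_vec less_Suc_eq_le)
  from pascal_hermitian_form_pos [of i k "\<lambda>i. v $ i", OF this]
  show "Re (v \<bullet>c (pascal_mat k *\<^sub>v v)) > 0"
    unfolding quadratic_form_eq [OF pascal_mat_carrier v(1)] by simp
qed (fact pascal_mat_hermitian)

abbreviation lyap_block :: "nat \<Rightarrow> complex mat" where
  "lyap_block k \<equiv> jordan_block (Suc k) (-1)"

lemma pascal_mat_mult_block:
  assumes "i \<le> k" "j \<le> k"
  shows "(pascal_mat k * lyap_block k) $$ (i, j) =
    of_real ((if j = 0 then 0 else pascal_weight i (j - 1)) - pascal_weight i j)"
proof -
  have "(pascal_mat k * lyap_block k) $$ (i, j)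
      = (\<Sum>l\<le>k. of_real (pascal_weight i l) * (if l = j then -1 else if Suc l = j then 1 else 0))"
    using assms by (simp add: scalar_prod_def atLeast0LessThan lessThan_Suc_atMost del: sum.lessThan_Suc)
  \<comment> \<open>Column \<open>j\<close> of the block has -1 in row \<open>j\<close> and 1 in row
    \<open>j - 1\<close>. For \<open>j = 0\<close> both deltas hit row 0, and the inner
    \<open>if\<close> cancels the second.\<close>
  also have "\<dots> = (\<Sum>l\<le>k. (if l = j then - of_real (pascal_weight i j) else 0)
      + (if l = j - 1 then (if j = 0 then 0 else of_real (pascal_weight i (j - 1))) else 0))"
    by (intro sum.cong refl) auto
  also have "\<dots> = of_real ((if j = 0 then 0 else pascal_weight i (j - 1)) - pascal_weight i j)"
    using assms by (cases j) (simp_all add: sum.distrib sum.delta)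
  finally show ?thesis .
qed

lemma lyapunov_pascal_mat:
  "mat_adjoint (lyap_block k) * pascal_mat k + pascal_mat k * lyap_block k =
    mat (Suc k) (Suc k) (\<lambda>(i, j). if i = 0 \<and> j = 0 then -2 else 0)" (is "?l = ?r")
proof (rule eq_matI)
  note adj = mat_adjoint_carrier [OF jordan_block_carrier [of "Suc k" "-1 :: complex"]]
  fix i j assume "i < dim_row ?r" "j < dim_col ?r"
  then have ij: "i \<le> k" "j \<le> k" by auto
  \<comment> \<open>As the Pascal matrix is Hermitian, L^* P is the adjoint of P L, so the entries
    of one product suffice.\<close>
  have "(mat_adjoint (lyap_block k) * pascal_mat k) $$ (i, j) = cnj ((pascal_mat k * lyap_block k) $$ (j, i))"
    using ij adj by (simp add: scalar_prod_def mat_adjoint_index [OF jordan_block_carrier]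
        pascal_weight_sym [of j] mult.commute if_distrib [of cnj] cong: if_cong)
  then have "?l $$ (i, j) = of_real ((if i = 0 then 0 else pascal_weight (i - 1) j)
      + (if j = 0 then 0 else pascal_weight i (j - 1)) - 2 * pascal_weight i j)"
    using ij adj
    by (simp add: pascal_mat_mult_block pascal_weight_sym [of j] del: index_mult_mat(1))
  also have "\<dots> = ?r $$ (i, j)"
    unfolding pascal_weight_lyapunov using ij by simp
  finally show "?l $$ (i, j) = ?r $$ (i, j)" .
qed (auto simp: mat_adjoint_def)

lemma neg_semidef_lyapunov_pascal_mat:
  "neg_semidef_mat (Suc k) (mat_adjoint (lyap_block k) * pascal_mat k + pascal_mat k * lyap_block k)"
  unfolding lyapunov_pascal_mat neg_semidef_mat_def hermitian_mat_def
proof (intro conjI ballI)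
  let ?M = "mat (Suc k) (Suc k) (\<lambda>(i, j). if i = 0 \<and> j = 0 then -2 else 0) :: complex mat"
  have M: "?M \<in> carrier_mat (Suc k) (Suc k)" by simp
  show "mat_adjoint ?M = ?M"
    using mat_adjoint_carrier [OF M] by (intro eq_matI) (auto simp: mat_adjoint_index [OF M])
  fix v :: "complex vec" assume v: "v \<in> carrier_vec (Suc k)"
  have "v \<bullet>c (?M *\<^sub>v v) = (\<Sum>i\<le>k. \<Sum>j\<le>k. if i = 0 then if j = 0 then - 2 * (v $ 0 * cnj (v $ 0)) else 0 else 0)"
    unfolding quadratic_form_eq [OF M v] by (intro sum.cong refl) auto
  also have "\<dots> = (\<Sum>i\<le>k. if i = 0 then - 2 * (v $ 0 * cnj (v $ 0)) else 0)"
    by (intro sum.cong refl) (auto simp: sum.delta)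
  also have "\<dots> = - 2 * (v $ 0 * cnj (v $ 0))"
    by (simp add: sum.delta)
  also have "\<dots> = of_real (- 2 * (cmod (v $ 0))\<^sup>2)"
    by (simp only: complex_norm_square [symmetric] of_real_mult of_real_minus of_real_numeral)
  finally show "Re (v \<bullet>c (?M *\<^sub>v v)) \<le> 0" by simp
qed

text \<open>The characteristic polynomial is a power of z + 1, so -1 is the only eigenvalue and its
  real part is negative.\<close>

lemma lyapunov_stable_block: "lyapunov_stable (lyap_block k)"
proof -
  have "ev = -1" if "eigenvalue (lyap_block k) ev" for ev
    using that unfolding eigenvalue_root_char_poly [OF jordan_block_carrier] jordan_block_char_poly poly_power power_eq_0_iff
    by (simp add: eq_neg_iff_add_eq_0 add.commute)
  then show ?thesis unfolding lyapunov_stable_def by fastforce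
qed

section \<open>Action of the Jordan block on real coefficient vectors\<close>

definition of_real_vec :: "nat \<Rightarrow> (nat \<Rightarrow> real) \<Rightarrow> complex vec" where
  "of_real_vec n x = vec n (\<lambda>i. of_real (x i))"

lemma of_real_vec_carrier [simp]: "of_real_vec n x \<in> carrier_vec n"
  by (simp add: of_real_vec_def)

text \<open>The ones of the block lie on the superdiagonal. Its last row has none, which agrees with
  \<open>fdiff\<close> because \<open>x (Suc k) = 0\<close>.\<close>

lemma lyap_block_mult_of_real_vec:
  assumes "x (Suc k) = 0"
  shows "lyap_block k *\<^sub>v of_real_vec (Suc k) x = of_real_vec (Suc k) (fdiff x)"
proof (rule eq_vecI)
  fix i assume "i < dim_vec (of_real_vec (Suc k) (fdiff x))"
  then have i: "i \<le> k" by (simp add: of_real_vec_def)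
  have "(lyap_block k *\<^sub>v of_real_vec (Suc k) x) $ i
      = (\<Sum>l\<le>k. (if i = l then - 1 else if Suc i = l then 1 else 0) * of_real (x l))"
    using i by (simp add: of_real_vec_def scalar_prod_def atLeast0LessThan lessThan_Suc_atMost
        del: sum.lessThan_Suc)
  also have "\<dots> = (\<Sum>l\<le>k. (if l = i then - of_real (x i) else 0) + (if l = Suc i then of_real (x (Suc i)) else 0))"
    by (intro sum.cong refl) auto
  also have "\<dots> = of_real (x (Suc i)) - of_real (x i)"
    using i assms by (auto simp: sum.distrib sum.delta not_le le_Suc_eq dest: le_antisym)
  finally show "(lyap_block k *\<^sub>v of_real_vec (Suc k) x) $ i = of_real_vec (Suc k) (fdiff x) $ i"
    using i by (simp add: of_real_vec_def)
qed (simp add: of_real_vec_def)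

lemma funpow_lyap_block_of_real_vec:
  assumes "\<And>i. k < i \<Longrightarrow> x i = 0"
  shows "((*\<^sub>v) (lyap_block k) ^^ j) (of_real_vec (Suc k) x) = of_real_vec (Suc k) ((fdiff ^^ j) x)"
  by (induction j) (simp_all add: lyap_block_mult_of_real_vec funpow_fdiff_eq_0 [OF assms])

lemma P_norm_pascal_mat:
  "P_norm (pascal_mat k) (of_real_vec (Suc k) x) = sqrt (pascal_form k x x)"
  unfolding P_norm_def quadratic_form_eq [OF pascal_mat_carrier of_real_vec_carrier]
  by (simp add: pascal_form_def of_real_vec_def)

lemma not_strongly_stable:
  assumes "(\<exists>m\<ge>1. p = 4 * m) \<or> (\<exists>m. p = 4 * m + 1)" and order: "rk_linear_order a b p p"
  shows "\<not> strongly_stable a b p"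
proof
  assume "strongly_stable a b p"
  obtain k q where grow: "\<forall>\<^sub>F \<tau> in at_right 0. pascal_form k (diff_seed q k \<tau>) (diff_seed q k \<tau>)
    < pascal_form k (\<lambda>i. \<Sum>j\<le>p. \<tau> ^ j / fact j * (fdiff ^^ j) (diff_seed q k \<tau>) i)
        (\<lambda>i. \<Sum>j\<le>p. \<tau> ^ j / fact j * (fdiff ^^ j) (diff_seed q k \<tau>) i)"
    using exists_pascal_energy_increase [OF assms(1)] by blast
  have "\<exists>\<tau>0>0. \<forall>\<tau>. 0 < \<tau> \<and> \<tau> \<le> \<tau>0 \<longrightarrow> (\<forall>u0\<in>carrier_vec (Suc k).
      P_norm (pascal_mat k) (rk_step a b p (lyap_block k) \<tau> u0) \<le> P_norm (pascal_mat k) u0)"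
    by (rule \<open>strongly_stable a b p\<close> [unfolded strongly_stable_def, rule_format,
          OF _ jordan_block_carrier pascal_mat_carrier])
      (simp_all only: lyapunov_stable_block pos_def_pascal_mat neg_semidef_lyapunov_pascal_mat One_nat_def Suc_le_mono le0 simp_thms)
  then obtain \<tau>0 where "\<tau>0 > 0" and stable: "\<And>\<tau>. 0 < \<tau> \<Longrightarrow> \<tau> \<le> \<tau>0 \<Longrightarrow> \<forall>u0\<in>carrier_vec (Suc k).
      P_norm (pascal_mat k) (rk_step a b p (lyap_block k) \<tau> u0) \<le> P_norm (pascal_mat k) u0"
    by blast
  \<comment> \<open>The seed that gains energy changes with \<tau>. This contradicts stability
    because \<tau>0 is uniform in \<open>u0\<close>: a single step size below \<tau>0 with its own
    seed is enough.\<close>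
  have "\<forall>\<^sub>F \<tau> in at_right (0::real). \<tau> \<in> {0<..<\<tau>0}"
    using \<open>\<tau>0 > 0\<close> by (rule eventually_at_right_real)
  from eventually_happens [OF eventually_conj [OF grow this]] obtain \<tau> where \<tau>: "0 < \<tau>" "\<tau> \<le> \<tau>0"
    and less: "pascal_form k (diff_seed q k \<tau>) (diff_seed q k \<tau>)
    < pascal_form k (\<lambda>i. \<Sum>j\<le>p. \<tau> ^ j / fact j * (fdiff ^^ j) (diff_seed q k \<tau>) i)
        (\<lambda>i. \<Sum>j\<le>p. \<tau> ^ j / fact j * (fdiff ^^ j) (diff_seed q k \<tau>) i)"
    by auto
  have "rk_step a b p (lyap_block k) \<tau> (of_real_vec (Suc k) (diff_seed q k \<tau>))
      = of_real_vec (Suc k) (\<lambda>i. \<Sum>j\<le>p. \<tau> ^ j / fact j * (fdiff ^^ j) (diff_seed q k \<tau>) i)"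
  proof -
    have "diff_seed q k \<tau> i = 0" if "k < i" for i
      using that by (simp add: diff_seed_def)
    then have iterate: "((*\<^sub>v) (lyap_block k) ^^ j) (of_real_vec (Suc k) (diff_seed q k \<tau>))
        = of_real_vec (Suc k) ((fdiff ^^ j) (diff_seed q k \<tau>))" for j
      by (rule funpow_lyap_block_of_real_vec)
    show ?thesis
      unfolding rk_step_eq [OF jordan_block_carrier of_real_vec_carrier] iterate
      by (intro eq_vecI)
        (simp_all add: of_real_vec_def rk_linear_order_imp_stability_coeff [OF order] del: funpow.simps)
  qed
  moreover have "P_norm (pascal_mat k) (rk_step a b p (lyap_block k) \<tau> (of_real_vec (Suc k) (diff_seed q k \<tau>)))
      \<le> P_norm (pascal_mat k) (of_real_vec (Suc k) (diff_seed q k \<tau>))"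
    by (rule bspec [OF stable [OF \<tau>] of_real_vec_carrier])
  ultimately show False
    using less by (simp only: P_norm_pascal_mat real_sqrt_le_iff not_less [symmetric]) simp
qed

theorem corollary1:
  fixes p :: nat and a :: "nat \<Rightarrow> nat \<Rightarrow> real" and b :: "nat \<Rightarrow> real"
  assumes "(\<exists>m\<ge>1. p = 4 * m) \<or> (\<exists>m. p = 4 * m + 1)"
    and "rk_linear_order a b p p"
  shows "is_stability_function a b p (truncated_exp p) \<and> \<not> strongly_stable a b p"
  using is_stability_function_truncated_exp [OF assms(2)] not_strongly_stable [OF assms] by blast

end
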